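(* Let $p,q\ge 0$ be integers with $n=p+q\ge 1$. a) The subspaces $$\overline{\mathbf 2},\quad \overline{\mathbf{02}},\quad \overline{\mathbf{12}},\quad \overline{\mathbf{23}}$$ of the real Clifford algebra $\mathcal{C}\!\ell^{\mathbb R}(p,q)$ are closed with respect to the commutator $U,V\mapsto[U,V]=UV-VU$ and hence form Lie algebras with respect to the commutator. b) The subspaces $$\overline{\mathbf 2},\quad \overline{\mathbf{02}},\quad \overline{\mathbf{12}},\quad \overline{\mathbf{23}},\quad \overline{\mathbf{0123}},$$ $$\overline{\mathbf{02}}\oplus i\,\overline{\mathbf{02}},\quad \overline{\mathbf{12}}\oplus i\,\overline{\mathbf{12}},\quad \overline{\mathbf{23}}\oplus i\,\overline{\mathbf{23}},$$ $$\overline{\mathbf 2}\oplus i\,\overline{\mathbf 0},\quad \overline{\mathbf 2}\oplus i\,\overline{\mathbf 1},\quad \overline{\mathbf 2}\oplus i\,\overline{\mathbf 2},\quad \overline{\mathbf 2}\oplus i\,\overline{\mathbf 3},$$ $$\overline{\mathbf{02}}\oplus i\,\overline{\mathbf{13}},\quad \overline{\mathbf{12}}\oplus i\,\overline{\mathbf{03}},\quad \overline{\mathbf{23}}\oplus i\,\overline{\mathbf{01}}$$ of the complex Clifford algebra $\mathcal{C}\!\ell^{\mathbb C}(p,q)$ are closed with respect to the commutator and hence form Lie algebras with respect to the commutator.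
   Context: $\mathcal{C}\!\ell^{\mathbb F}(p,q)$ ($\mathbb F=\mathbb R$ or $\mathbb C$) is the Clifford algebra over $\mathbb F$ with identity $e$ and generators $e^1,\dots,e^n$, $n=p+q$, satisfying $e^ae^b+e^be^a=2\eta^{ab}e$, where $\eta$ is diagonal with $p$ entries $+1$ followed by $q$ entries $-1$. The $2^n$ elements $e$ and $e^{a_1\ldots a_k}=e^{a_1}\cdots e^{a_k}$ ($a_1<\dots<a_k$, $1\le k\le n$) form an $\mathbb F$-basis. $\mathcal{C}\!\ell^{\mathbb F}_k(p,q)$ is the $\mathbb F$-span of the basis elements with $k$ indices (rank $k$; $k=0$ means the span of $e$), and it is zero for $k>n$. We regard $\mathcal{C}\!\ell^{\mathbb R}(p,q)\subset\mathcal{C}\!\ell^{\mathbb C}(p,q)=\mathcal{C}\!\ell^{\mathbb R}(p,q)\oplus i\,\mathcal{C}\!\ell^{\mathbb R}(p,q)$. For $k\in\{0,1,2,3\}$, $\overline{\mathbf k}=\bigoplus_{j\equiv k \,(\mathrm{mod}\,4)}\mathcal{C}\!\ell^{\mathbb R}_j(p,q)$; $\overline{\mathbf{kl}}=\overline{\mathbf k}\oplus\overline{\mathbf l}$, and $\overline{\mathbf{0123}}=\mathcal{C}\!\ell^{\mathbb R}(p,q)$. All these are real vector spaces; subspaces and Lie algebras inside $\mathcal{C}\!\ell^{\mathbb C}(p,q)$ are understood over $\mathbb R$. *)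

theory Defs
  imports Complex_Main "HOL-Library.Set_Algebras" "HOL-Library.Type_Length"
begin

section \<open>Clifford algebras\<close>

definition clifford_metric :: "nat \<Rightarrow> nat \<Rightarrow> nat \<Rightarrow> 'f::field" where
  "clifford_metric p a b = (if a = b then if a \<le> p then 1 else - 1 else 0)"

text \<open>The empty product is the identity, so the blade of the empty set is \<open>e\<close>.\<close>

definition clifford_blade :: "(nat \<Rightarrow> 'a::monoid_mult) \<Rightarrow> nat set \<Rightarrow> 'a" where
  "clifford_blade gen A = prod_list (map gen (sorted_list_of_set A))"

text \<open>
  The whole type \<^typ>\<open>'a\<close> is the Clifford algebra; only the generators with index in
  \<open>{1..p + q}\<close> matter. A type for every signature is constructed at the end of this theory.
\<close>

locale clifford_algebra = vector_space scale
  for scale :: "'f::field \<Rightarrow> 'a::ring_1 \<Rightarrow> 'a" +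
  fixes gen :: "nat \<Rightarrow> 'a" and p q :: nat
  assumes mult_scale_left: "scale c x * y = scale c (x * y)"
    and mult_scale_right: "x * scale c y = scale c (x * y)"
    and gen_anticommute: "a \<in> {1..p + q} \<Longrightarrow> b \<in> {1..p + q} \<Longrightarrow>
          gen a * gen b + gen b * gen a = scale (2 * clifford_metric p a b) 1"
    and inj_blade: "inj_on (clifford_blade gen) (Pow {1..p + q})"
    and independent_blades: "independent (clifford_blade gen ` Pow {1..p + q})"
    and span_blades: "span (clifford_blade gen ` Pow {1..p + q}) = UNIV"

text \<open>
  In the next definitions \<open>scale\<close> is a real scalar multiplication. For a complex Clifford
  algebra it is the restriction to real scalars, so that the real Clifford algebra is the real
  span of the blades.
\<close>

abbreviation real_scale :: "(complex \<Rightarrow> 'a \<Rightarrow> 'a) \<Rightarrow> real \<Rightarrow> 'a \<Rightarrow> 'a" where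
  "real_scale scale \<equiv> \<lambda>r. scale (complex_of_real r)"

definition clifford_rank ::
    "(real \<Rightarrow> 'a::ring_1 \<Rightarrow> 'a) \<Rightarrow> (nat \<Rightarrow> 'a) \<Rightarrow> nat \<Rightarrow> nat \<Rightarrow> 'a set" where
  "clifford_rank scale gen n k =
     module.span scale (clifford_blade gen ` {A. A \<subseteq> {1..n} \<and> card A = k})"

text \<open>
  The sum of all rank subspaces with rank congruent to \<open>k\<close> modulo 4. Sums of several such
  subspaces are formed with the elementwise sum of sets from \<^theory>\<open>HOL-Library.Set_Algebras\<close>;
  that these sums are direct is shown below.
\<close>

definition quaternion_type ::
    "(real \<Rightarrow> 'a::ring_1 \<Rightarrow> 'a) \<Rightarrow> (nat \<Rightarrow> 'a) \<Rightarrow> nat \<Rightarrow> nat \<Rightarrow> 'a set" where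
  "quaternion_type scale gen n k =
     module.span scale (\<Union>j\<in>{j. j mod 4 = k}. clifford_rank scale gen n j)"


section \<open>Lie algebras inside a vector space\<close>

definition commutator :: "'a::ring \<Rightarrow> 'a \<Rightarrow> 'a" where
  "commutator U V = U * V - V * U"

locale lie_algebra_on = vector_space scale
  for scale :: "'f::field \<Rightarrow> 'a::ab_group_add \<Rightarrow> 'a" +
  fixes L :: "'a set" and bracket :: "'a \<Rightarrow> 'a \<Rightarrow> 'a"
  assumes subspace: "subspace L"
    and closed: "x \<in> L \<Longrightarrow> y \<in> L \<Longrightarrow> bracket x y \<in> L"
    and add_left: "x \<in> L \<Longrightarrow> y \<in> L \<Longrightarrow> z \<in> L \<Longrightarrow> bracket (x + y) z = bracket x z + bracket y z"
    and add_right: "x \<in> L \<Longrightarrow> y \<in> L \<Longrightarrow> z \<in> L \<Longrightarrow> bracket x (y + z) = bracket x y + bracket x z"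
    and scale_left: "x \<in> L \<Longrightarrow> y \<in> L \<Longrightarrow> bracket (scale c x) y = scale c (bracket x y)"
    and scale_right: "x \<in> L \<Longrightarrow> y \<in> L \<Longrightarrow> bracket x (scale c y) = scale c (bracket x y)"
    and alternating: "x \<in> L \<Longrightarrow> bracket x x = 0"
    and jacobi: "x \<in> L \<Longrightarrow> y \<in> L \<Longrightarrow> z \<in> L \<Longrightarrow>
          bracket x (bracket y z) + bracket y (bracket z x) + bracket z (bracket x y) = 0"


section \<open>The sums are direct\<close>

context vector_space
begin

lemma independent_span_Int:
  assumes "independent (X \<union> Y)" "X \<inter> Y = {}"
  shows "span X \<inter> span Y = {0}"
proof -
  have X: "independent X" and Y: "independent Y"
    using assms(1) independent_mono by blast+
  have "v = 0" if v: "v \<in> span X" "v \<in> span Y" for v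
  proof -
    let ?r = "representation (X \<union> Y) v"
    have "?r = representation X v" "?r = representation Y v"
      by (rule representation_extend[OF assms(1)]; use v in simp)+
    then have "?r b = 0" for b
      using representation_ne_zero[of X v b] representation_ne_zero[of Y v b] assms(2)
      by (metis disjoint_iff)
    then show ?thesis
      using sum_nonzero_representation_eq[OF assms(1), of v] v(1) span_mono[of X "X \<union> Y"]
      by auto
  qed
  then show ?thesis
    using span_zero by blast
qed

end

context clifford_algebra
begin

lemma blade_sum_eq_0:
  assumes "(\<Sum>A\<in>Pow {1..p + q}. scale (c A) (clifford_blade gen A)) = 0"
    and "A \<subseteq> {1..p + q}"
  shows "c A = 0"
proof -
  let ?P = "Pow {1..p + q}" and ?b = "clifford_blade gen"
  have "(\<Sum>v\<in>?b ` ?P. scale (c (inv_into ?P ?b v)) v) = (\<Sum>A\<in>?P. scale (c A) (?b A))"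
    by (simp add: sum.reindex[OF inj_blade] inv_into_f_f[OF inj_blade] del: One_nat_def)
  then have "c (inv_into ?P ?b (?b A)) = 0"
    using assms by (intro independentD[OF independent_blades, of "?b ` ?P"]) auto
  then show ?thesis
    using assms(2) inv_into_f_f[OF inj_blade, of A] by auto
qed

end

lemma vector_space_real_scale:
  assumes "vector_space scale"
  shows "vector_space (real_scale scale)"
proof -
  interpret vector_space scale by fact
  show ?thesis
    by unfold_locales (auto simp: algebra_simps)
qed

lemma real_span_image:
  fixes scale :: "real \<Rightarrow> 'a::ab_group_add \<Rightarrow> 'a"
  assumes "vector_space scale" "inj_on b P" "finite P"
  shows "module.span scale (b ` P) = range (\<lambda>c. \<Sum>A\<in>P. scale (c A) (b A))"
proof -
  interpret vector_space scale by fact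
  have 1: "(\<Sum>v\<in>b ` P. scale (u v) v) = (\<Sum>A\<in>P. scale ((u \<circ> b) A) (b A))" for u
    by (simp add: sum.reindex[OF assms(2)])
  have 2: "(\<Sum>A\<in>P. scale (c A) (b A)) = (\<Sum>v\<in>b ` P. scale ((c \<circ> inv_into P b) v) v)" for c
    using assms(2) by (simp add: sum.reindex inv_into_f_f cong: sum.cong)
  show ?thesis
    unfolding span_finite[OF finite_imageI[OF assms(3)]]
    by (auto simp: image_iff) (metis 1, metis 2)
qed

lemma real_independent_blades:
  assumes "clifford_algebra scale gen p q"
  shows "\<not> module.dependent (real_scale scale) (clifford_blade gen ` Pow {1..p + q})"
proof -
  interpret clifford_algebra scale gen p q by fact
  interpret R: vector_space "real_scale scale"
    by (rule vector_space_real_scale) unfold_locales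
  show ?thesis
    unfolding R.independent_explicit_module
    using independentD[OF independent_blades, of _ "\<lambda>v. complex_of_real (_ v)"] by auto
qed

lemma clifford_complexification:
  assumes "clifford_algebra scale gen p q"
  defines "R \<equiv> module.span (real_scale scale) (clifford_blade gen ` Pow {1..p + q})"
  shows "R + scale \<i> ` R = UNIV" "R \<inter> scale \<i> ` R = {0}"
proof -
  interpret clifford_algebra scale gen p q by fact
  interpret R: vector_space "real_scale scale"
    by (rule vector_space_real_scale) unfold_locales
  let ?b = "clifford_blade gen" and ?P = "Pow {1..p + q}"
  have R: "R = range (\<lambda>c. \<Sum>A\<in>?P. real_scale scale (c A) (?b A))"
    unfolding R_def by (rule real_span_image[OF R.vector_space_axioms inj_blade]) simp
  have "x \<in> R + scale \<i> ` R" for x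
  proof -
    have "x \<in> span (?b ` ?P)"
      unfolding span_blades by simp
    then obtain u where x: "x = (\<Sum>v\<in>?b ` ?P. scale (u v) v)"
      by (subst (asm) span_finite) auto
    have "x = (\<Sum>A\<in>?P. scale (u (?b A)) (?b A))"
      unfolding x by (simp add: sum.reindex[OF inj_blade] del: One_nat_def)
    also have "\<dots> = (\<Sum>A\<in>?P. real_scale scale (Re (u (?b A))) (?b A) +
        scale \<i> (real_scale scale (Im (u (?b A))) (?b A)))"
      by (intro sum.cong refl) (simp flip: complex_eq scale_left_distrib)
    also have "\<dots> = (\<Sum>A\<in>?P. real_scale scale (Re (u (?b A))) (?b A)) +
        scale \<i> (\<Sum>A\<in>?P. real_scale scale (Im (u (?b A))) (?b A))"
      by (simp only: sum.distrib scale_sum_right)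
    finally show ?thesis
      unfolding R by (intro set_plus_intro[THEN back_subst[of "\<lambda>v. v \<in> _"]]) auto
  qed
  then show "R + scale \<i> ` R = UNIV"
    by blast
  have "v = 0" if v: "v \<in> R" "v \<in> scale \<i> ` R" for v
  proof -
    from v obtain c d where
      c: "v = (\<Sum>A\<in>?P. real_scale scale (c A) (?b A))" and
      d: "v = scale \<i> (\<Sum>A\<in>?P. real_scale scale (d A) (?b A))"
      unfolding R by blast
    have "(\<Sum>A\<in>?P. scale (complex_of_real (c A) - \<i> * complex_of_real (d A)) (?b A)) =
        (\<Sum>A\<in>?P. real_scale scale (c A) (?b A)) -
        scale \<i> (\<Sum>A\<in>?P. real_scale scale (d A) (?b A))"
      by (simp add: scale_left_diff_distrib sum_subtractf scale_sum_right)
    also have "\<dots> = v - v"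
      unfolding c[symmetric] d[symmetric] ..
    finally have "(\<Sum>A\<in>?P. scale (complex_of_real (c A) - \<i> * complex_of_real (d A)) (?b A)) = 0"
      by simp
    then have "complex_of_real (c A) - \<i> * complex_of_real (d A) = 0" if "A \<in> ?P" for A
      using that by (intro blade_sum_eq_0[where c = "\<lambda>A. complex_of_real (c A) - \<i> * complex_of_real (d A)"]) auto
    then have "c A = 0" if "A \<in> ?P" for A
      using that by (auto simp: complex_eq_iff)
    then show ?thesis
      unfolding c by (intro sum.neutral) auto
  qed
  moreover have "0 \<in> R"
    unfolding R_def by (rule R.span_zero)
  ultimately show "R \<inter> scale \<i> ` R = {0}"
    by (auto simp: image_iff)
qed

lemma quaternion_type_eq:
  assumes "vector_space scale"
  shows "quaternion_type scale gen n k =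
    module.span scale (clifford_blade gen ` {A. A \<subseteq> {1..n} \<and> card A mod 4 = k})"
proof -
  interpret vector_space scale by fact
  let ?B = "\<lambda>P. clifford_blade gen ` {A. A \<subseteq> {1..n} \<and> P (card A)}"
  have "(\<Union>j\<in>{j. j mod 4 = k}. span (?B (\<lambda>i. i = j))) \<subseteq> span (?B (\<lambda>i. i mod 4 = k))"
    by (intro UN_least span_mono) auto
  moreover have "?B (\<lambda>i. i mod 4 = k) \<subseteq> span (\<Union>j\<in>{j. j mod 4 = k}. span (?B (\<lambda>i. i = j)))"
    by (auto intro!: span_base)
  ultimately show ?thesis
    unfolding quaternion_type_def clifford_rank_def span_eq by simp
qed

lemma quaternion_types_direct:
  assumes "vector_space scale"
    and "\<not> module.dependent scale (clifford_blade gen ` Pow {1..n})"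
    and "inj_on (clifford_blade gen) (Pow {1..n})"
    and "k \<notin> K"
  shows "quaternion_type scale gen n k \<inter>
    module.span scale (\<Union>l\<in>K. quaternion_type scale gen n l) = {0}"
proof -
  interpret vector_space scale by fact
  let ?B = "\<lambda>P. clifford_blade gen ` {A. A \<subseteq> {1..n} \<and> P (card A mod 4)}"
  have "(\<Union>l\<in>K. quaternion_type scale gen n l) \<subseteq> span (?B (\<lambda>i. i \<in> K))"
    unfolding quaternion_type_eq[OF assms(1)] by (intro UN_least span_mono) auto
  then have "span (\<Union>l\<in>K. quaternion_type scale gen n l) \<subseteq> span (?B (\<lambda>i. i \<in> K))"
    by (intro span_minimal) auto
  moreover have "span (?B (\<lambda>i. i = k)) \<inter> span (?B (\<lambda>i. i \<in> K)) = {0}"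
  proof (rule independent_span_Int)
    show "independent (?B (\<lambda>i. i = k) \<union> ?B (\<lambda>i. i \<in> K))"
      by (rule independent_mono[OF assms(2)]) auto
    show "?B (\<lambda>i. i = k) \<inter> ?B (\<lambda>i. i \<in> K) = {}"
      using assms(3,4) by (force dest: inj_onD)
  qed
  ultimately show ?thesis
    using span_zero unfolding quaternion_type_eq[OF assms(1)] by blast
qed

lemma quaternion_types_sum:
  assumes "vector_space scale"
  shows "quaternion_type scale gen n 0 + quaternion_type scale gen n 1 +
      quaternion_type scale gen n 2 + quaternion_type scale gen n 3 =
    module.span scale (clifford_blade gen ` Pow {1..n})"
proof -
  interpret vector_space scale by fact
  have plus: "span X + span Y = span (X \<union> Y)" for X Y
    by (auto simp: span_Un set_plus_def)
  have "m mod 4 = 0 \<or> m mod 4 = 1 \<or> m mod 4 = 2 \<or> m mod 4 = 3" for m :: nat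
    by presburger
  then show ?thesis
    unfolding quaternion_type_eq[OF assms] plus image_Un[symmetric]
    by (intro arg_cong[where f = span] arg_cong[where f = "image _"]) auto
qed


section \<open>A Clifford algebra for every signature\<close>

text \<open>
  The carrier has a coordinate for every blade, and the product of the blades of \<open>A\<close> and \<open>B\<close>
  is \<open>blade_sign p A B\<close> times the blade of the symmetric difference. The type parameters
  \<^typ>\<open>'p\<close> and \<^typ>\<open>'q\<close> encode the signature through their lengths; length 0 is available as
  the numeral type \<^typ>\<open>0\<close>.
\<close>

definition blade_sign :: "nat \<Rightarrow> nat set \<Rightarrow> nat set \<Rightarrow> 'f::field" where
  "blade_sign p A B =
     (\<Prod>a\<in>A. \<Prod>b\<in>B. if b < a then - 1 else if a = b then clifford_metric p a a else 1)"

lemma prod_sym_diff: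
  fixes f :: "'b \<Rightarrow> 'f::field"
  assumes "finite A" "finite B" "\<And>a. f a * f a = 1"
  shows "prod f (sym_diff A B) = prod f A * prod f B"
proof -
  have "prod f A = prod f (A - B) * prod f (A \<inter> B)" "prod f B = prod f (B - A) * prod f (A \<inter> B)"
    using assms by (simp_all add: Int_commute prod.Int_Diff[of A f B] prod.Int_Diff[of B f A] mult.commute)
  moreover have "prod f (A \<inter> B) * prod f (A \<inter> B) = 1"
    by (simp add: assms(3) flip: prod.distrib)
  moreover have "prod f (sym_diff A B) = prod f (A - B) * prod f (B - A)"
    using assms by (intro prod.union_disjoint) auto
  ultimately show ?thesis
    by (simp add: mult.assoc mult.left_commute[of _ "prod f (A \<inter> B)"])
qed

lemma blade_sign_sym_diff_left:
  assumes "finite A" "finite B"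
  shows "blade_sign p (sym_diff A B) C = blade_sign p A C * blade_sign p B C"
  unfolding blade_sign_def
  by (intro prod_sym_diff assms)
    (auto simp: clifford_metric_def simp flip: prod.distrib intro!: prod.neutral)

lemma blade_sign_sym_diff_right:
  assumes "finite B" "finite C"
  shows "blade_sign p A (sym_diff B C) = blade_sign p A B * blade_sign p A C"
  unfolding blade_sign_def
  by (subst prod_sym_diff[OF assms]) (auto simp: clifford_metric_def prod.distrib)

typedef (overloaded) ('f::zero, 'p::len0, 'q::len0) clifford =
    "{x :: nat set \<Rightarrow> 'f. \<forall>A. \<not> A \<subseteq> {1..LENGTH('p) + LENGTH('q)} \<longrightarrow> x A = 0}"
  morphisms coords of_coords
  by (rule exI[of _ "\<lambda>_. 0"]) simp

setup_lifting type_definition_clifford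

lemma coords_outside: "\<not> A \<subseteq> {1..LENGTH('p) + LENGTH('q)} \<Longrightarrow> coords x A = 0"
  for x :: "('f::zero, 'p::len0, 'q::len0) clifford"
  using coords[of x] by blast

instantiation clifford :: (field, len0, len0) ring_1
begin

lift_definition zero_clifford :: "('a, 'b, 'c) clifford" is "\<lambda>_. 0"
  by simp

lift_definition one_clifford :: "('a, 'b, 'c) clifford" is "\<lambda>A. if A = {} then 1 else 0"
  by auto

lift_definition plus_clifford ::
    "('a, 'b, 'c) clifford \<Rightarrow> ('a, 'b, 'c) clifford \<Rightarrow> ('a, 'b, 'c) clifford"
  is "\<lambda>x y A. x A + y A"
  by auto

lift_definition minus_clifford ::
    "('a, 'b, 'c) clifford \<Rightarrow> ('a, 'b, 'c) clifford \<Rightarrow> ('a, 'b, 'c) clifford"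
  is "\<lambda>x y A. x A - y A"
  by auto

lift_definition uminus_clifford :: "('a, 'b, 'c) clifford \<Rightarrow> ('a, 'b, 'c) clifford"
  is "\<lambda>x A. - x A"
  by auto

lift_definition times_clifford ::
    "('a, 'b, 'c) clifford \<Rightarrow> ('a, 'b, 'c) clifford \<Rightarrow> ('a, 'b, 'c) clifford"
  is "\<lambda>x y C. if C \<subseteq> {1..LENGTH('b) + LENGTH('c)}
       then \<Sum>A\<in>Pow {1..LENGTH('b) + LENGTH('c)}.
              blade_sign LENGTH('b) A (sym_diff A C) * x A * y (sym_diff A C)
       else 0"
  by auto

instance
proof
  fix x y z :: "('a, 'b, 'c) clifford"
  define N where "N = {1..LENGTH('b) + LENGTH('c)}"
  let ?s = "blade_sign LENGTH('b) :: _ \<Rightarrow> _ \<Rightarrow> 'a"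
  have fin: "finite A" if "A \<subseteq> N" for A
    using that by (rule finite_subset) (simp add: N_def)
  have times: "coords (u * v) C =
      (if C \<subseteq> N then \<Sum>A\<in>Pow N. ?s A (sym_diff A C) * coords u A * coords v (sym_diff A C) else 0)"
    for u v :: "('a, 'b, 'c) clifford" and C
    unfolding N_def by transfer simp
  have assoc: "sym_diff (sym_diff A B) C = sym_diff A (sym_diff B C)" for A B C :: "nat set"
    by blast
  show "x * y * z = x * (y * z)"
  proof (rule coords_inject[THEN iffD1], rule ext)
    fix D
    show "coords (x * y * z) D = coords (x * (y * z)) D"
    proof (cases "D \<subseteq> N")
      case True
      have *: "?s (sym_diff A B) E * ?s A B = ?s A (sym_diff B E) * ?s B E"
        if "A \<subseteq> N" "B \<subseteq> N" "E \<subseteq> N" for A B E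
        using that by (simp add: blade_sign_sym_diff_left blade_sign_sym_diff_right fin)
      let ?t = "\<lambda>A B. ?s (sym_diff A B) (sym_diff (sym_diff A B) D) * ?s A B *
          coords x A * coords y B * coords z (sym_diff (sym_diff A B) D)"
      have "coords (x * y * z) D = (\<Sum>C\<in>Pow N. \<Sum>A\<in>Pow N.
          ?s C (sym_diff C D) * (?s A (sym_diff A C) * coords x A * coords y (sym_diff A C)) *
          coords z (sym_diff C D))"
        using True by (simp add: times sum_distrib_left sum_distrib_right)
      also have "\<dots> = (\<Sum>A\<in>Pow N. \<Sum>C\<in>Pow N.
          ?s C (sym_diff C D) * (?s A (sym_diff A C) * coords x A * coords y (sym_diff A C)) *
          coords z (sym_diff C D))"
        by (rule sum.swap)
      also have "\<dots> = (\<Sum>A\<in>Pow N. \<Sum>B\<in>Pow N. ?t A B)"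
      proof (rule sum.cong[OF refl])
        fix A assume A: "A \<in> Pow N"
        have sd: "sym_diff A (sym_diff A B) = B" for B
          by blast
        show "(\<Sum>C\<in>Pow N.
            ?s C (sym_diff C D) * (?s A (sym_diff A C) * coords x A * coords y (sym_diff A C)) *
            coords z (sym_diff C D)) = (\<Sum>B\<in>Pow N. ?t A B)"
          by (rule sum.reindex_bij_witness[of _ "sym_diff A" "sym_diff A"])
            (use A in \<open>auto simp only: sd mult.assoc\<close>; blast)+
      qed
      also have "\<dots> = (\<Sum>A\<in>Pow N. \<Sum>B\<in>Pow N.
          ?s A (sym_diff A D) * coords x A * (?s B (sym_diff B (sym_diff A D)) * coords y B *
          coords z (sym_diff B (sym_diff A D))))"
      proof (intro sum.cong refl)
        fix A B assume AB: "A \<in> Pow N" "B \<in> Pow N"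
        define E where "E = sym_diff (sym_diff A B) D"
        have E: "sym_diff B (sym_diff A D) = E" "sym_diff A D = sym_diff B E" "E \<subseteq> N"
          using AB True unfolding E_def by blast+
        have "?t A B = (?s (sym_diff A B) E * ?s A B) * (coords x A * coords y B * coords z E)"
          unfolding E_def by (simp only: mult.assoc)
        also have "\<dots> = ?s A (sym_diff B E) * coords x A * (?s B E * coords y B * coords z E)"
          unfolding *[OF AB[unfolded Pow_iff] E(3)] by (simp only: mult_ac)
        finally show "?t A B = ?s A (sym_diff A D) * coords x A *
            (?s B (sym_diff B (sym_diff A D)) * coords y B *
             coords z (sym_diff B (sym_diff A D)))"
          unfolding E(1) unfolding E(2) .
      qed
      also have "\<dots> = coords (x * (y * z)) D"
      proof -
        have "coords (y * z) (sym_diff A D) = (\<Sum>B\<in>Pow N.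
            ?s B (sym_diff B (sym_diff A D)) * coords y B * coords z (sym_diff B (sym_diff A D)))"
          if "A \<in> Pow N" for A
        proof -
          have "sym_diff A D \<subseteq> N"
            using True that by blast
          then show ?thesis
            unfolding times by (rule if_P)
        qed
        then show ?thesis
          unfolding times[of x] using True by (simp add: sum_distrib_left)
      qed
      finally show ?thesis .
    qed (simp add: times)
  qed
  have [simp]: "coords (1 :: ('a, 'b, 'c) clifford) A = (if A = {} then 1 else 0)" for A
    by transfer simp
  have out: "\<not> A \<subseteq> N \<Longrightarrow> coords u A = 0" for u :: "('a, 'b, 'c) clifford" and A
    unfolding N_def by (rule coords_outside)
  have s: "?s {} A = 1" "?s A {} = 1" for A
    by (simp_all add: blade_sign_def)
  show "1 * x = x"
  proof (rule coords_inject[THEN iffD1], rule ext)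
    fix C
    have "(\<Sum>A\<in>Pow N. ?s A (sym_diff A C) * (if A = {} then 1 else 0) * coords x (sym_diff A C))
        = (\<Sum>A\<in>Pow N. if A = {} then coords x C else 0)"
      by (intro sum.cong) (auto simp: s)
    then show "coords (1 * x) C = coords x C"
      by (simp add: times out fin)
  qed
  show "x * 1 = x"
  proof (rule coords_inject[THEN iffD1], rule ext)
    fix C
    have "(\<Sum>A\<in>Pow N. ?s A (sym_diff A C) * coords x A * (if sym_diff A C = {} then 1 else 0))
        = (\<Sum>A\<in>Pow N. if A = C then coords x C else 0)"
    proof (intro sum.cong refl)
      fix A
      have "sym_diff A C = {} \<longleftrightarrow> A = C"
        by blast
      then show "?s A (sym_diff A C) * coords x A * (if sym_diff A C = {} then 1 else 0) =
          (if A = C then coords x C else 0)"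
        by (simp add: s)
    qed
    then show "coords (x * 1) C = coords x C"
      by (simp add: times out fin N_def[symmetric] sum.delta del: Diff_eq_empty_iff Un_empty)
  qed
  show "(x + y) * z = x * z + y * z"
    by transfer (auto simp: fun_eq_iff algebra_simps sum.distrib)
  show "x * (y + z) = x * y + x * z"
    by transfer (auto simp: fun_eq_iff algebra_simps sum.distrib)
  show "x + y + z = x + (y + z)" "x + y = y + x" "0 + x = x" "- x + x = 0" "x - y = x + - y"
    by (transfer; auto simp: fun_eq_iff)+
  show "(0 :: ('a, 'b, 'c) clifford) \<noteq> 1"
    by transfer (auto simp: fun_eq_iff)
qed

end

lift_definition scale_clifford ::
    "'f::field \<Rightarrow> ('f, 'p::len0, 'q::len0) clifford \<Rightarrow> ('f, 'p, 'q) clifford"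
  is "\<lambda>c x A. c * x A"
  by auto

lift_definition basis_clifford :: "nat set \<Rightarrow> ('f::field, 'p::len0, 'q::len0) clifford"
  is "\<lambda>B A. if A = B \<and> A \<subseteq> {1..LENGTH('p) + LENGTH('q)} then 1 else 0"
  by auto

lemma coords_sum: "coords (sum f S) A = (\<Sum>i\<in>S. coords (f i) A)"
  for f :: "_ \<Rightarrow> ('f::field, 'p::len0, 'q::len0) clifford"
  by (induction S rule: infinite_finite_induct)
    (simp_all add: zero_clifford.rep_eq plus_clifford.rep_eq)

lemma basis_clifford_mult:
  assumes "A \<subseteq> {1..LENGTH('p) + LENGTH('q)}" "B \<subseteq> {1..LENGTH('p) + LENGTH('q)}"
  shows "basis_clifford A * basis_clifford B =
    scale_clifford (blade_sign LENGTH('p) A B)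
      (basis_clifford (sym_diff A B) :: ('f::field, 'p::len0, 'q::len0) clifford)"
proof (rule coords_inject[THEN iffD1], rule ext)
  fix C
  let ?N = "{1..LENGTH('p) + LENGTH('q)}" and ?s = "blade_sign LENGTH('p) :: _ \<Rightarrow> _ \<Rightarrow> 'f"
  let ?e = "basis_clifford :: _ \<Rightarrow> ('f, 'p, 'q) clifford"
  have sd: "sym_diff A C = B \<longleftrightarrow> C = sym_diff A B"
    by blast
  show "coords (?e A * ?e B) C = coords (scale_clifford (?s A B) (?e (sym_diff A B))) C"
  proof (cases "C \<subseteq> ?N")
    case True
    then have sub: "sym_diff A C \<subseteq> ?N"
      using assms by blast
    have "(\<Sum>A'\<in>Pow ?N. ?s A' (sym_diff A' C) * coords (?e A) A' * coords (?e B) (sym_diff A' C))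
        = (\<Sum>A'\<in>Pow ?N. if A' = A then ?s A (sym_diff A C) * coords (?e B) (sym_diff A C) else 0)"
      by (intro sum.cong) (auto simp: basis_clifford.rep_eq)
    also have "\<dots> = ?s A (sym_diff A C) * coords (?e B) (sym_diff A C)"
      using assms by (simp add: sum.delta)
    also have "\<dots> = (if sym_diff A C = B then ?s A B else 0)"
      using sub by (auto simp: basis_clifford.rep_eq)
    finally show ?thesis
      using True unfolding sd
      by (simp add: times_clifford.rep_eq scale_clifford.rep_eq basis_clifford.rep_eq)
  qed (simp_all add: coords_outside)
qed

lemma blade_clifford:
  assumes "A \<subseteq> {1..LENGTH('p) + LENGTH('q)}"
  shows "clifford_blade (\<lambda>a. basis_clifford {a}) A =
    (basis_clifford A :: ('f::field, 'p::len0, 'q::len0) clifford)"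
proof -
  have "finite A"
    using assms finite_subset by blast
  then show ?thesis
    using assms
  proof (induction A rule: finite_linorder_min_induct)
    case empty
    show ?case
      unfolding clifford_blade_def
      by (rule coords_inject[THEN iffD1])
        (auto simp: basis_clifford.rep_eq one_clifford.rep_eq)
  next
    case (insert a A)
    have a: "a \<notin> A"
      using insert.hyps by auto
    have "sorted_list_of_set (insert a A) = a # sorted_list_of_set A"
      using insert.hyps a by (simp add: insort_is_Cons less_imp_le)
    then have "clifford_blade (\<lambda>a. basis_clifford {a}) (insert a A) =
        (basis_clifford {a} * basis_clifford A :: ('f, 'p, 'q) clifford)"
      using insert by (simp add: clifford_blade_def)
    also have "\<dots> = scale_clifford (blade_sign LENGTH('p) {a} A) (basis_clifford (sym_diff {a} A))"
      using insert.prems by (intro basis_clifford_mult) auto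
    also have "(blade_sign LENGTH('p) {a} A :: 'f) = 1"
      unfolding blade_sign_def using insert.hyps by (auto intro!: prod.neutral)
    also have "sym_diff {a} A = insert a A"
      using a by blast
    finally show ?case
      by (simp add: scale_clifford_def coords_inverse map_fun_def)
  qed
qed

theorem clifford_algebra_exists:
  "clifford_algebra scale_clifford (\<lambda>a. basis_clifford {a} :: ('f::field, 'p::len0, 'q::len0) clifford)
     LENGTH('p) LENGTH('q)"
proof -
  interpret vector_space "scale_clifford :: 'f \<Rightarrow> ('f, 'p, 'q) clifford \<Rightarrow> _"
    by unfold_locales (transfer; simp add: fun_eq_iff algebra_simps)+
  let ?N = "{1..LENGTH('p) + LENGTH('q)}"
  let ?e = "basis_clifford :: _ \<Rightarrow> ('f, 'p, 'q) clifford"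
  have blades: "clifford_blade (\<lambda>a. ?e {a}) ` Pow ?N = ?e ` Pow ?N"
    by (intro image_cong) (auto simp: blade_clifford)
  have coords_e: "coords (?e B) A = (if A = B then 1 else 0)" if "A \<subseteq> ?N" for A B
    using that by (auto simp: basis_clifford.rep_eq)
  have inj: "inj_on ?e (Pow ?N)"
  proof (rule inj_onI)
    fix A B assume "A \<in> Pow ?N" "B \<in> Pow ?N" "?e A = ?e B"
    then have "coords (?e B) A = 1"
      using coords_e[of A A] by simp
    then show "A = B"
      using coords_e[of A B] \<open>A \<in> Pow ?N\<close> by (simp split: if_splits)
  qed
  have coords_lin: "coords (\<Sum>B\<in>Pow ?N. scale_clifford (c B) (?e B)) A = c A"
    if "A \<subseteq> ?N" for c A
    using that
    by (simp add: coords_sum scale_clifford.rep_eq coords_e if_distrib[of "\<lambda>x. _ * x"]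
        sum.delta cong: if_cong)
  show ?thesis
  proof unfold_locales
    fix c :: 'f and x y :: "('f, 'p, 'q) clifford"
    show "scale_clifford c x * y = scale_clifford c (x * y)"
      "x * scale_clifford c y = scale_clifford c (x * y)"
      by (transfer; auto simp: fun_eq_iff sum_distrib_left mult_ac)+
  next
    fix a b assume ab: "a \<in> ?N" "b \<in> ?N"
    have one: "?e {} = 1"
      by (rule coords_inject[THEN iffD1])
        (auto simp: basis_clifford.rep_eq one_clifford.rep_eq)
    have "?e {a} * ?e {b} + ?e {b} * ?e {a} =
        scale_clifford (blade_sign LENGTH('p) {a} {b} + blade_sign LENGTH('p) {b} {a})
          (?e (sym_diff {a} {b}))"
      using ab by (simp add: basis_clifford_mult scale_left_distrib Un_commute)
    also have "\<dots> = scale_clifford (2 * clifford_metric LENGTH('p) a b) 1"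
      by (cases "a = b") (auto simp: blade_sign_def clifford_metric_def one)
    finally show "?e {a} * ?e {b} + ?e {b} * ?e {a} =
        scale_clifford (2 * clifford_metric LENGTH('p) a b) 1" .
  next
    show "inj_on (clifford_blade (\<lambda>a. ?e {a})) (Pow ?N)"
      using inj by (simp add: inj_on_def blade_clifford)
  next
    have "\<forall>v\<in>?e ` Pow ?N. u v = 0" if "(\<Sum>v\<in>?e ` Pow ?N. scale_clifford (u v) v) = 0" for u
    proof clarify
      fix A assume "A \<subseteq> ?N"
      then show "u (?e A) = 0"
        using coords_lin[of A "\<lambda>B. u (?e B)"] that
        by (simp add: sum.reindex[OF inj] zero_clifford.rep_eq del: One_nat_def)
    qed
    then show "independent (clifford_blade (\<lambda>a. ?e {a}) ` Pow ?N)"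
      unfolding blades
      by (intro independent_if_scalars_zero) auto
  next
    have "x = (\<Sum>B\<in>Pow ?N. scale_clifford (coords x B) (?e B))" for x
    proof (rule coords_inject[THEN iffD1], rule ext)
      fix A
      show "coords x A = coords (\<Sum>B\<in>Pow ?N. scale_clifford (coords x B) (?e B)) A"
        using coords_lin[of A "coords x"] coords_outside[of A] by metis
    qed
    then have "x \<in> span (?e ` Pow ?N)" for x
      by (metis (no_types, lifting) imageI span_base span_scale span_sum)
    then show "span (clifford_blade (\<lambda>a. ?e {a}) ` Pow ?N) = UNIV"
      unfolding blades by blast
  qed
qed

end

theory Submission
  imports Defs
begin

text \<open>
  Two blades with index sets \<open>A\<close> and \<open>B\<close> commute up to the sign
  \<open>(-1) ^ (|A| |B| + |A \<inter> B|)\<close>, and their product is plus or minus the blade of the symmetric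
  difference, whose index set has \<open>|A| + |B| - 2 |A \<inter> B|\<close> elements. If the commutator does not
  vanish, then \<open>|A \<inter> B|\<close> has the parity of \<open>|A| |B| + 1\<close>. Hence the commutator of two blades of
  ranks \<open>k\<close> and \<open>l\<close> lies in rank \<open>k + l + 2 k l + 2\<close> modulo 4: a single residue class determined
  by \<open>k\<close> and \<open>l\<close> modulo 4. All the subspaces of the theorem are real spans of blades with ranks
  in some \<open>K\<close> and of \<open>\<i>\<close> times blades with ranks in some \<open>M\<close>, so that closedness becomes a
  finite check on residue classes.
\<close>

section \<open>Ranks modulo 4\<close>

definition bracket_type :: "nat \<Rightarrow> nat \<Rightarrow> nat" where
  "bracket_type k l = (k + l + 2 * k * l + 2) mod 4"

text \<open>The residues form a set so that a sum of quaternion types becomes the span of a single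
  such family, indexed by the union.\<close>

definition blades_of_type :: "(nat \<Rightarrow> 'a::monoid_mult) \<Rightarrow> nat \<Rightarrow> nat set \<Rightarrow> 'a set" where
  "blades_of_type gen n K = clifford_blade gen ` {A. A \<subseteq> {1..n} \<and> card A mod 4 \<in> K}"

lemma blades_of_type_Un: "blades_of_type gen n K \<union> blades_of_type gen n M = blades_of_type gen n (K \<union> M)"
  unfolding blades_of_type_def by auto

lemma blades_of_type_empty: "blades_of_type gen n {} = {}"
  unfolding blades_of_type_def by simp

lemma quaternion_type_eq_span_blades:
  assumes "vector_space scale"
  shows "quaternion_type scale gen n k = module.span scale (blades_of_type gen n {k})"
  unfolding quaternion_type_eq[OF assms] blades_of_type_def by simp

lemma bracket_type_mod: "bracket_type (k mod 4) (l mod 4) = bracket_type k l"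
  unfolding bracket_type_def by (intro mod_add_cong mod_mult_cong) simp_all

lemma bracket_type_eq_card:
  assumes "finite A" "finite B" "odd (card A * card B + card (A \<inter> B))"
  shows "card (sym_diff A B) mod 4 = bracket_type (card A) (card B)"
proof -
  define c where "c = card (A \<inter> B)"
  obtain m where m: "card A * card B + c = 2 * m + 1"
    using assms(3) unfolding c_def by (elim oddE)
  have "card A = card (A - B) + c" "card B = card (B - A) + c"
    using assms(1,2) card_Int_Diff[of A B] card_Int_Diff[of B A]
    unfolding c_def by (simp_all add: Int_commute)
  moreover have "card (sym_diff A B) = card (A - B) + card (B - A)"
    using assms(1,2) by (intro card_Un_disjoint) auto
  \<comment> \<open>The choice of \<open>m\<close> gives
    \<open>2 * c + 2 * (card A * card B) = 4 * m + 2\<close>. The multiple of 4 stands on the left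
    to avoid subtraction of naturals.\<close>
  ultimately have "card (sym_diff A B) + 4 * (m + 1) = card A + card B + 2 * (card A * card B) + 2"
    using m by simp
  then show ?thesis
    unfolding bracket_type_def by (metis mod_mult_self2 mult.assoc)
qed

section \<open>Products and commutation of blades\<close>

lemma clifford_blade_empty [simp]: "clifford_blade gen {} = 1"
  by (simp add: clifford_blade_def)

text \<open>The least index stands first in the product, so the inductions over index sets below add
  an element smaller than all others.\<close>

lemma clifford_blade_insert_less:
  assumes "finite A" "\<And>b. b \<in> A \<Longrightarrow> a < b"
  shows "clifford_blade gen (insert a A) = gen a * clifford_blade gen A"
proof -
  have "a \<notin> A"
    using assms(2) by blast
  then show ?thesis
    using assms by (simp add: clifford_blade_def insort_is_Cons less_imp_le)
qed

context clifford_algebra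
begin

lemma gen_anticommute':
  assumes "a \<in> {1..p + q}" "b \<in> {1..p + q}" "a \<noteq> b"
  shows "gen a * gen b = - (gen b * gen a)"
  using gen_anticommute[OF assms(1,2)] assms(3)
  by (simp add: clifford_metric_def eq_neg_iff_add_eq_0)

text \<open>The defining relation fixes only twice the square; dividing by 2 requires
  \<open>2 \<noteq> 0\<close>.\<close>

lemma gen_square:
  assumes "a \<in> {1..p + q}" "(2::'f) \<noteq> 0"
  shows "gen a * gen a = 1 \<or> gen a * gen a = - 1"
proof -
  have "scale 2 (gen a * gen a) = gen a * gen a + gen a * gen a"
    using scale_left_distrib[of 1 1] by simp
  also have "\<dots> = scale 2 (scale (clifford_metric p a a) 1)"
    using gen_anticommute[OF assms(1) assms(1)] by simp
  finally have "gen a * gen a = scale (clifford_metric p a a) 1"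
    by (rule scale_left_imp_eq[OF assms(2)])
  then show ?thesis
    by (auto simp: clifford_metric_def)
qed

text \<open>\<open>gen a\<close> moves right past smaller generators, changing sign each time, until
  it reaches its place in the order or meets its own copy, where the square is \<open>1\<close> or
  \<open>- 1\<close>. The sign stays open, since it does not affect membership in a span.\<close>

lemma gen_mult_blade:
  assumes "finite A" "A \<subseteq> {1..p + q}" "a \<in> {1..p + q}" "(2::'f) \<noteq> 0"
  shows "gen a * clifford_blade gen A = clifford_blade gen (sym_diff {a} A) \<or>
         gen a * clifford_blade gen A = - clifford_blade gen (sym_diff {a} A)"
  using assms
proof (induction A rule: finite_linorder_min_induct)
  case empty
  then show ?case
    using clifford_blade_insert_less[of "{}" a gen] by simp
next
  case (insert b A)
  have blade: "clifford_blade gen (insert b A) = gen b * clifford_blade gen A"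
    using insert.hyps by (intro clifford_blade_insert_less) auto
  have bA: "b \<notin> A"
    using insert.hyps by auto
  consider "a < b" | "a = b" | "b < a"
    by linarith
  then show ?case
  proof cases
    case 1
    then have "sym_diff {a} (insert b A) = insert a (insert b A)"
      using insert.hyps by fastforce
    moreover have "clifford_blade gen (insert a (insert b A)) = gen a * clifford_blade gen (insert b A)"
      using 1 insert.hyps by (intro clifford_blade_insert_less) auto
    ultimately show ?thesis
      by simp
  next
    case 2
    then have "sym_diff {a} (insert b A) = A"
      using bA by auto
    moreover have "gen a * clifford_blade gen (insert b A) = gen a * gen a * clifford_blade gen A"
      using blade 2 by (simp add: mult.assoc)
    ultimately show ?thesis
      using gen_square[OF insert.prems(2,3)] by (elim disjE) simp_all
  next
    case 3
    then have "sym_diff {a} (insert b A) = insert b (sym_diff {a} A)"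
      using bA by auto
    moreover have "clifford_blade gen (insert b (sym_diff {a} A)) =
        gen b * clifford_blade gen (sym_diff {a} A)"
      using 3 insert.hyps by (intro clifford_blade_insert_less) auto
    moreover have "gen a * clifford_blade gen (insert b A) = - (gen b * (gen a * clifford_blade gen A))"
      unfolding blade mult.assoc[symmetric]
      using gen_anticommute'[of a b] insert.prems 3 by simp
    ultimately show ?thesis
      using insert.IH insert.prems by auto
  qed
qed

text \<open>The generators of \<open>A\<close>, largest first, multiply the blade of
  \<open>B\<close> from the left, each toggling its own index.\<close>

lemma blade_mult_blade:
  assumes "finite A" "A \<subseteq> {1..p + q}" "B \<subseteq> {1..p + q}" "(2::'f) \<noteq> 0"
  shows "clifford_blade gen A * clifford_blade gen B = clifford_blade gen (sym_diff A B) \<or>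
         clifford_blade gen A * clifford_blade gen B = - clifford_blade gen (sym_diff A B)"
  using assms
proof (induction A rule: finite_linorder_min_induct)
  case (insert a A)
  let ?C = "sym_diff A B"
  have "clifford_blade gen (insert a A) = gen a * clifford_blade gen A"
    using insert.hyps by (intro clifford_blade_insert_less) auto
  then have "clifford_blade gen (insert a A) * clifford_blade gen B = gen a * clifford_blade gen ?C \<or>
      clifford_blade gen (insert a A) * clifford_blade gen B = - (gen a * clifford_blade gen ?C)"
    using insert.IH insert.prems by (auto simp: mult.assoc)
  moreover have "sym_diff {a} ?C = sym_diff (insert a A) B"
    using insert.hyps by auto
  moreover have "finite ?C" "?C \<subseteq> {1..p + q}"
    using insert.hyps insert.prems finite_subset[of B "{1..p + q}"] by auto
  ultimately show ?case
    using gen_mult_blade[of ?C a] insert.prems by auto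
qed simp

text \<open>Passing \<open>gen b\<close> changes the sign exactly if \<open>b \<noteq> a\<close>.
  The number of changes is the difference of the two cardinalities; their sum has the same parity
  and avoids subtraction.\<close>

lemma gen_blade_commute:
  assumes "finite B" "B \<subseteq> {1..p + q}" "a \<in> {1..p + q}"
  shows "gen a * clifford_blade gen B =
    (- 1) ^ (card B + card ({a} \<inter> B)) * (clifford_blade gen B * gen a)"
  using assms
proof (induction B rule: finite_linorder_min_induct)
  case (insert b B)
  have blade: "clifford_blade gen (insert b B) = gen b * clifford_blade gen B"
    using insert.hyps by (intro clifford_blade_insert_less) auto
  have bB: "b \<notin> B"
    using insert.hyps by auto
  have IH: "gen a * clifford_blade gen B =
      (- 1) ^ (card B + card ({a} \<inter> B)) * (clifford_blade gen B * gen a)"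
    using insert.prems by (intro insert.IH) auto
  show ?case
  proof (cases "a = b")
    case True
    then have "gen a * (gen b * clifford_blade gen B) = gen b * (gen a * clifford_blade gen B)"
      by (simp only:)
    moreover have "card (insert b B) + card ({a} \<inter> insert b B) = Suc (Suc (card B + card ({a} \<inter> B)))"
      using True bB insert.hyps by simp
    ultimately show ?thesis
      unfolding blade IH by (simp add: minus_one_power_iff mult.assoc)
  next
    case False
    have "gen a * (gen b * clifford_blade gen B) = - (gen b * (gen a * clifford_blade gen B))"
      unfolding mult.assoc[symmetric] using gen_anticommute'[of a b] insert.prems False by simp
    moreover have "card (insert b B) + card ({a} \<inter> insert b B) = Suc (card B + card ({a} \<inter> B))"
      using False bB insert.hyps by simp
    ultimately show ?thesis
      unfolding blade IH by (simp add: minus_one_power_iff mult.assoc)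
  qed
qed simp

text \<open>The generators of \<open>A\<close> pass the blade of \<open>B\<close> one at a time, and
  the exponents from \<open>gen_blade_commute\<close> add up over \<open>A\<close>.\<close>

lemma blade_commute:
  assumes "finite A" "A \<subseteq> {1..p + q}" "B \<subseteq> {1..p + q}"
  shows "clifford_blade gen A * clifford_blade gen B =
    (- 1) ^ (card A * card B + card (A \<inter> B)) * (clifford_blade gen B * clifford_blade gen A)"
  using assms
proof (induction A rule: finite_linorder_min_induct)
  case (insert a A)
  let ?b = "clifford_blade gen"
  have blade: "?b (insert a A) = gen a * ?b A"
    using insert.hyps by (intro clifford_blade_insert_less) auto
  have aA: "a \<notin> A"
    using insert.hyps by auto
  have finB: "finite B"
    using insert.prems finite_subset by blast
  have "insert a A \<inter> B = ({a} \<inter> B) \<union> (A \<inter> B)"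
    by auto
  then have card: "card (insert a A \<inter> B) = card ({a} \<inter> B) + card (A \<inter> B)"
    using aA finB insert.hyps by (simp only:) (intro card_Un_disjoint; auto)
  have "?b (insert a A) * ?b B = (- 1) ^ (card A * card B + card (A \<inter> B)) * (gen a * ?b B * ?b A)"
    using insert.IH insert.prems unfolding blade by (simp add: minus_one_power_iff mult.assoc)
  also have "gen a * ?b B = (- 1) ^ (card B + card ({a} \<inter> B)) * (?b B * gen a)"
    using insert.prems by (intro gen_blade_commute finB) auto
  also have "(- 1) ^ (card A * card B + card (A \<inter> B)) *
      ((- 1) ^ (card B + card ({a} \<inter> B)) * (?b B * gen a) * ?b A) =
      (- 1) ^ (card A * card B + card (A \<inter> B) + (card B + card ({a} \<inter> B))) * (?b B * ?b (insert a A))"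
    unfolding blade by (simp only: power_add mult.assoc)
  also have "card A * card B + card (A \<inter> B) + (card B + card ({a} \<inter> B)) =
      card (insert a A) * card B + card (insert a A \<inter> B)"
    using aA insert.hyps unfolding card by simp
  finally show ?case .
qed simp

text \<open>Blades either commute or anticommute; in the second case the commutator is twice their
  product. Twice is written as a sum, so that the result applies to subspaces for either scalar
  multiplication.\<close>

lemma commutator_blades_cases:
  assumes "A \<subseteq> {1..p + q}" "B \<subseteq> {1..p + q}" "(2::'f) \<noteq> 0"
  obtains "commutator (clifford_blade gen A) (clifford_blade gen B) = 0"
  | C where "C \<subseteq> {1..p + q}" "card C mod 4 = bracket_type (card A) (card B)"
      "commutator (clifford_blade gen A) (clifford_blade gen B) =
        clifford_blade gen C + clifford_blade gen C"
  | C where "C \<subseteq> {1..p + q}" "card C mod 4 = bracket_type (card A) (card B)"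
      "commutator (clifford_blade gen A) (clifford_blade gen B) =
        - (clifford_blade gen C + clifford_blade gen C)"
proof (cases "even (card A * card B + card (A \<inter> B))")
  case True
  have "finite A"
    using assms(1) finite_subset by blast
  then show ?thesis
    using that(1) blade_commute[of A B] assms True by (simp add: commutator_def)
next
  case False
  let ?b = "clifford_blade gen"
  have fin: "finite A" "finite B"
    using assms(1,2) finite_subset by blast+
  have "?b A * ?b B = - (?b B * ?b A)"
    using blade_commute[OF fin(1) assms(1,2)] False by simp
  then have "commutator (?b A) (?b B) = ?b A * ?b B + ?b A * ?b B"
    by (simp add: commutator_def)
  moreover have "sym_diff A B \<subseteq> {1..p + q}"
    using assms(1,2) by blast
  ultimately show ?thesis
    using that(2,3)[of "sym_diff A B"] bracket_type_eq_card[OF fin False]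
      blade_mult_blade[OF fin(1) assms]
    by auto
qed

end

section \<open>Lie algebras spanned by blades\<close>

text \<open>
  The scalars of the ambient space are real, while the Clifford algebra may be complex, hence two
  scalar multiplications.
\<close>

lemma commutator_blades_in_subspace:
  fixes scale :: "'f::field \<Rightarrow> 'a::ring_1 \<Rightarrow> 'a" and rscale :: "real \<Rightarrow> 'a \<Rightarrow> 'a"
  assumes "clifford_algebra scale gen p q" "(2::'f) \<noteq> 0"
    and "vector_space rscale" "module.subspace rscale T"
    and "x \<in> blades_of_type gen (p + q) K" "y \<in> blades_of_type gen (p + q) M"
    and "\<And>k l. k \<in> K \<Longrightarrow> l \<in> M \<Longrightarrow> bracket_type k l \<in> J"
    and "blades_of_type gen (p + q) J \<subseteq> T"
  shows "commutator x y \<in> T"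
proof -
  interpret clifford_algebra scale gen p q by fact
  interpret R: vector_space rscale by fact
  obtain A B where A: "A \<subseteq> {1..p + q}" "card A mod 4 \<in> K" "x = clifford_blade gen A"
    and B: "B \<subseteq> {1..p + q}" "card B mod 4 \<in> M" "y = clifford_blade gen B"
    using assms(5,6) unfolding blades_of_type_def by auto
  have T: "clifford_blade gen C \<in> T"
    if "C \<subseteq> {1..p + q}" "card C mod 4 = bracket_type (card A) (card B)" for C
    using assms(7)[OF A(2) B(2)] assms(8) that unfolding bracket_type_mod blades_of_type_def by auto
  from commutator_blades_cases[OF A(1) B(1) assms(2)] show ?thesis
  proof cases
    case 1
    then show ?thesis
      using R.subspace_0[OF assms(4)] by (simp add: A(3) B(3))
  next
    case (2 C)
    then show ?thesis
      using R.subspace_add[OF assms(4) T T] by (simp add: A(3) B(3))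
  next
    case (3 C)
    then show ?thesis
      using R.subspace_neg[OF assms(4) R.subspace_add[OF assms(4) T T]] by (simp add: A(3) B(3))
  qed
qed

text \<open>Bilinearity carries closedness from \<open>S\<close> to its span, one argument at a
  time; the Jacobi identity comes from associativity of the product.\<close>

lemma lie_algebra_on_span:
  fixes scale :: "'f::field \<Rightarrow> 'a::ring_1 \<Rightarrow> 'a"
  assumes "vector_space scale"
    and left: "\<And>c x y. scale c x * y = scale c (x * y)"
    and right: "\<And>c x y. x * scale c y = scale c (x * y)"
    and closed: "\<And>x y. x \<in> S \<Longrightarrow> y \<in> S \<Longrightarrow> commutator x y \<in> module.span scale S"
  shows "lie_algebra_on scale (module.span scale S) commutator"
proof -
  interpret vector_space scale by fact
  have add: "commutator (x + y) z = commutator x z + commutator y z"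
    "commutator z (x + y) = commutator z x + commutator z y" for x y z :: 'a
    by (simp_all add: commutator_def algebra_simps)
  have smult: "commutator (scale c x) y = scale c (commutator x y)"
    "commutator x (scale c y) = scale c (commutator x y)" for c x y
    by (simp_all add: commutator_def left right scale_right_diff_distrib)
  have zero: "commutator 0 x = 0" "commutator x 0 = 0" for x :: 'a
    by (simp_all add: commutator_def)
  have left_span: "commutator x y \<in> span S" if "x \<in> span S" "y \<in> S" for x y
    using that(1)
    by (induction rule: span_induct_alt)
      (auto simp: zero add smult intro: span_zero span_add span_scale closed that(2))
  have "commutator x y \<in> span S" if "x \<in> span S" "y \<in> span S" for x y
    using that(2)
    by (induction rule: span_induct_alt)
      (auto simp: zero add smult intro: span_zero span_add span_scale left_span[OF that(1)])
  then show ?thesis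
    by unfold_locales (auto simp: add smult, auto simp: commutator_def algebra_simps)
qed

lemma lie_algebra_on_real_types:
  fixes scale :: "real \<Rightarrow> 'a::ring_1 \<Rightarrow> 'a"
  assumes "clifford_algebra scale gen p q"
    and "\<And>k l. k \<in> K \<Longrightarrow> l \<in> K \<Longrightarrow> bracket_type k l \<in> K"
  shows "lie_algebra_on scale (module.span scale (blades_of_type gen (p + q) K)) commutator"
proof -
  interpret clifford_algebra scale gen p q by fact
  show ?thesis
    by (intro lie_algebra_on_span vector_space_axioms mult_scale_left mult_scale_right
        commutator_blades_in_subspace[OF assms(1) _ vector_space_axioms subspace_span _ _ assms(2)]
        span_superset) auto
qed

text \<open>The three conditions treat the brackets of two real blades, of a real and an imaginary
  one, and of two imaginary ones; the last returns to \<open>K\<close> because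
  \<open>\<i> * \<i> = - 1\<close>.\<close>

lemma lie_algebra_on_complex_types:
  fixes scale :: "complex \<Rightarrow> 'a::ring_1 \<Rightarrow> 'a"
  assumes "clifford_algebra scale gen p q"
    and KK: "\<And>k l. k \<in> K \<Longrightarrow> l \<in> K \<Longrightarrow> bracket_type k l \<in> K"
    and KM: "\<And>k l. k \<in> K \<Longrightarrow> l \<in> M \<Longrightarrow> bracket_type k l \<in> M"
    and MM: "\<And>k l. k \<in> M \<Longrightarrow> l \<in> M \<Longrightarrow> bracket_type k l \<in> K"
  shows "lie_algebra_on (real_scale scale) (module.span (real_scale scale)
    (blades_of_type gen (p + q) K \<union> scale \<i> ` blades_of_type gen (p + q) M)) commutator"
proof -
  interpret clifford_algebra scale gen p q by fact
  have vs: "vector_space (real_scale scale)"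
    by (rule vector_space_real_scale) unfold_locales
  interpret R: vector_space "real_scale scale"
    by (fact vs)
  let ?K = "blades_of_type gen (p + q) K" and ?M = "blades_of_type gen (p + q) M"
  let ?S = "?K \<union> scale \<i> ` ?M"
  have KT: "?K \<subseteq> R.span ?S" and MT: "?M \<subseteq> {x. scale \<i> x \<in> R.span ?S}"
    by (auto intro: R.span_base)
  \<comment> \<open>For mixed brackets the factor \<open>\<i>\<close> is pulled out, leaving a
    bracket of real blades that has to lie in this preimage of the span.\<close>
  have sub: "R.subspace {x. scale \<i> x \<in> R.span ?S}"
  proof (rule R.subspaceI)
    fix c x assume "x \<in> {x. scale \<i> x \<in> R.span ?S}"
    then have "real_scale scale c (scale \<i> x) \<in> R.span ?S"
      by (intro R.span_scale) simp
    then show "real_scale scale c x \<in> {x. scale \<i> x \<in> R.span ?S}"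
      by (simp add: mult.commute)
  qed (auto simp: scale_right_distrib intro: R.span_add R.span_zero)
  note comm = commutator_blades_in_subspace[OF assms(1) _ vs]
  have scale_l: "commutator (scale c x) y = scale c (commutator x y)"
    and scale_r: "commutator x (scale c y) = scale c (commutator x y)" for c x y
    by (simp_all add: commutator_def mult_scale_left mult_scale_right scale_right_diff_distrib)
  \<comment> \<open>\<open>bracket_type\<close> is symmetric, so mixed brackets in the other order
    need no further hypothesis.\<close>
  have MK: "bracket_type k l \<in> M" if "k \<in> M" "l \<in> K" for k l
    using KM[OF that(2,1)] by (simp add: bracket_type_def ac_simps)
  have "commutator x y \<in> R.span ?S" if "x \<in> ?K" "y \<in> ?K" for x y
    using comm[OF _ R.subspace_span that KK KT] by simp
  moreover have "commutator x (scale \<i> y) \<in> R.span ?S" if "x \<in> ?K" "y \<in> ?M" for x y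
    using comm[OF _ sub that KM MT] by (simp add: scale_r)
  moreover have "commutator (scale \<i> x) y \<in> R.span ?S" if "x \<in> ?M" "y \<in> ?K" for x y
    using comm[OF _ sub that MK MT] by (simp add: scale_l)
  moreover have "commutator (scale \<i> x) (scale \<i> y) \<in> R.span ?S" if "x \<in> ?M" "y \<in> ?M" for x y
    using comm[OF _ R.subspace_span that MM KT] by (simp add: scale_l scale_r R.span_neg)
  ultimately have "commutator x y \<in> R.span ?S" if "x \<in> ?S" "y \<in> ?S" for x y
    using that by auto
  then show ?thesis
    by (intro lie_algebra_on_span vs mult_scale_left mult_scale_right)
qed

section \<open>Reduction of the listed subspaces to a check of residues\<close>

lemma span_plus_span:
  assumes "vector_space scale"
  shows "module.span scale X + module.span scale Y = module.span scale (X \<union> Y)"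
proof -
  interpret vector_space scale by fact
  show ?thesis
    by (auto simp: span_Un set_plus_def)
qed

text \<open>Multiplication by \<open>c\<close> is real linear. With \<open>c = \<i>\<close> this
  moves the imaginary summands inside the span.\<close>

lemma image_scale_real_span:
  assumes "vector_space scale"
  shows "scale c ` module.span (real_scale scale) X = module.span (real_scale scale) (scale c ` X)"
proof -
  interpret vector_space scale by fact
  interpret R: vector_space "real_scale scale"
    by (rule vector_space_real_scale) unfold_locales
  have "module_hom (real_scale scale) (real_scale scale) (scale c)"
    by unfold_locales (simp_all add: scale_right_distrib mult.commute)
  then show ?thesis
    by (rule module_hom.span_image[symmetric])
qed

theorem theorem2:
  fixes p q :: nat
  assumes "p + q \<ge> 1"
  shows
    "(\<forall>(scale :: real \<Rightarrow> 'a::ring_1 \<Rightarrow> 'a) gen.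
        clifford_algebra scale gen p q \<longrightarrow>
        (let W = quaternion_type scale gen (p + q)
         in \<forall>L \<in> {W 2, W 0 + W 2, W 1 + W 2, W 2 + W 3}.
              (\<forall>U\<in>L. \<forall>V\<in>L. commutator U V \<in> L) \<and>
              lie_algebra_on scale L commutator)) \<and>
     (\<forall>(scale :: complex \<Rightarrow> 'b::ring_1 \<Rightarrow> 'b) gen.
        clifford_algebra scale gen p q \<longrightarrow>
        (let W = quaternion_type (real_scale scale) gen (p + q);
             iW = (\<lambda>S. scale \<i> ` S)
         in \<forall>L \<in> {W 2, W 0 + W 2, W 1 + W 2, W 2 + W 3, W 0 + W 1 + W 2 + W 3,
                  (W 0 + W 2) + iW (W 0 + W 2),
                  (W 1 + W 2) + iW (W 1 + W 2),
                  (W 2 + W 3) + iW (W 2 + W 3),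
                  W 2 + iW (W 0), W 2 + iW (W 1), W 2 + iW (W 2), W 2 + iW (W 3),
                  (W 0 + W 2) + iW (W 1 + W 3),
                  (W 1 + W 2) + iW (W 0 + W 3),
                  (W 2 + W 3) + iW (W 0 + W 1)}.
              (\<forall>U\<in>L. \<forall>V\<in>L. commutator U V \<in> L) \<and>
              lie_algebra_on (real_scale scale) L commutator))"
  (is "?real \<and> ?complex")
proof
  show ?real
  proof (intro allI impI)
    fix scale :: "real \<Rightarrow> 'a \<Rightarrow> 'a" and gen
    assume alg: "clifford_algebra scale gen p q"
    then have vs: "vector_space scale"
      by (rule clifford_algebra.axioms)
    have closed: "(\<forall>U\<in>L. \<forall>V\<in>L. commutator U V \<in> L) \<and> lie_algebra_on scale L commutator"
      if "L = module.span scale (blades_of_type gen (p + q) K)"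
        "\<forall>k\<in>K. \<forall>l\<in>K. bracket_type k l \<in> K" for L K
      using lie_algebra_on_real_types[OF alg, of K] that lie_algebra_on.closed by blast
    show "let W = quaternion_type scale gen (p + q)
         in \<forall>L \<in> {W 2, W 0 + W 2, W 1 + W 2, W 2 + W 3}.
              (\<forall>U\<in>L. \<forall>V\<in>L. commutator U V \<in> L) \<and> lie_algebra_on scale L commutator"
      unfolding Let_def quaternion_type_eq_span_blades[OF vs] span_plus_span[OF vs]
        blades_of_type_Un ball_simps
      \<comment> \<open>Unification with the span reads off \<open>K\<close>, after which closedness
        is a computation with finitely many residues.\<close>
      by (rule conjI, rule closed, rule refl, simp add: bracket_type_def)+ (rule TrueI)
  qed
  show ?complex
  proof (intro allI impI)
    fix scale :: "complex \<Rightarrow> 'b \<Rightarrow> 'b" and gen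
    assume alg: "clifford_algebra scale gen p q"
    then have vs: "vector_space scale"
      by (rule clifford_algebra.axioms)
    note rvs = vector_space_real_scale[OF vs]
    have complex: "(\<forall>U\<in>L. \<forall>V\<in>L. commutator U V \<in> L) \<and> lie_algebra_on (real_scale scale) L commutator"
      if "L = module.span (real_scale scale)
          (blades_of_type gen (p + q) K \<union> scale \<i> ` blades_of_type gen (p + q) M)"
        "\<forall>k\<in>K. \<forall>l\<in>K. bracket_type k l \<in> K"
        "\<forall>k\<in>K. \<forall>l\<in>M. bracket_type k l \<in> M"
        "\<forall>k\<in>M. \<forall>l\<in>M. bracket_type k l \<in> K" for L K M
      using lie_algebra_on_complex_types[OF alg, of K M] that lie_algebra_on.closed by blast
    have real: "(\<forall>U\<in>L. \<forall>V\<in>L. commutator U V \<in> L) \<and> lie_algebra_on (real_scale scale) L commutator"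
      if "L = module.span (real_scale scale) (blades_of_type gen (p + q) K)"
        "\<forall>k\<in>K. \<forall>l\<in>K. bracket_type k l \<in> K" for L K
      \<comment> \<open>A subspace without imaginary part is the case of an empty
        \<open>M\<close>.\<close>
      using that by (intro complex[of _ K "{}"]) (simp_all add: blades_of_type_empty)
    show "let W = quaternion_type (real_scale scale) gen (p + q);
             iW = (\<lambda>S. scale \<i> ` S)
         in \<forall>L \<in> {W 2, W 0 + W 2, W 1 + W 2, W 2 + W 3, W 0 + W 1 + W 2 + W 3,
                  (W 0 + W 2) + iW (W 0 + W 2),
                  (W 1 + W 2) + iW (W 1 + W 2),
                  (W 2 + W 3) + iW (W 2 + W 3),
                  W 2 + iW (W 0), W 2 + iW (W 1), W 2 + iW (W 2), W 2 + iW (W 3),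
                  (W 0 + W 2) + iW (W 1 + W 3),
                  (W 1 + W 2) + iW (W 0 + W 3),
                  (W 2 + W 3) + iW (W 0 + W 1)}.
              (\<forall>U\<in>L. \<forall>V\<in>L. commutator U V \<in> L) \<and>
              lie_algebra_on (real_scale scale) L commutator"
      unfolding Let_def quaternion_type_eq_span_blades[OF rvs] span_plus_span[OF rvs]
        image_scale_real_span[OF vs] blades_of_type_Un ball_simps
      \<comment> \<open>\<open>real\<close> fits the first five subspaces; the others have an
        imaginary summand, so \<open>refl\<close> cannot match there and \<open>complex\<close>
        takes over.\<close>
      by (rule conjI,
          ((rule real, rule refl, simp add: bracket_type_def; fail)
            | ((rule complex, rule refl); simp add: bracket_type_def)))+ (rule TrueI)
  qed
qed

end
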